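(* Let $d,k$ be positive integers with $k\mid d$, let $Y\subset\mathbb{R}^{d/k}$ be a finite set and $\gamma>0$. Let $f:Y\to\{-1,1\}$ and $F:\{-1,1\}^k\to\{-1,1\}$ with $\deg_{2\gamma}(F)=D$, and let $G:Y^k\to\{-1,1\}$ be the composed function $G(Y_1,\dots,Y_k)=F(f(Y_1),\dots,f(Y_k))$, where $Y^k$ is viewed as a subset of $\mathbb{R}^d$ by concatenating blocks. Let $\mathcal{Y}\subseteq Y^k$. Suppose there exists $H\subseteq Y$ such that for every $(Y_1,\dots,Y_k)\in Y^k\setminus\mathcal{Y}$ there exists $i\in[k]$ with $Y_i\in Y\setminus H$. Then for every positive integer $t$, $$\deg_{(\gamma,W)}(G|_{\mathcal{Y}})\ge\tfrac12 tD\quad\text{for every } W\le\gamma\,2^{-k}\,w^*(f|_H,t)^{D/2}.$$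
   Context: For a finite $Z\subset\mathbb{R}^n$, a real polynomial on $\mathbb{R}^n$ is $p(z)=\sum_{S\subseteq[n]}c_S\chi_S(z)$ with $\chi_S(z)=\prod_{i\in S}z_i$; $\deg(p)=\max\{|S|:c_S\ne0\}$, weight $w(p)=\sum_S|c_S|$, non-constant weight $w^*(p)=\sum_{S\ne\emptyset}|c_S|$. For $g:Z\to\mathbb{R}$, $p$ is a $\gamma$-approximation to $g$ if $|g(z)-p(z)|\le\gamma$ for all $z\in Z$ (no constraint outside $Z$). $\deg_\gamma(g)$ is the minimum degree of a $\gamma$-approximation to $g$, and $\deg_{(\gamma,W)}(g)$ is the minimum degree of a $\gamma$-approximation $p$ to $g$ with $w(p)\le W$. For $g:Z\to\{-1,1\}$, the degree-$t$ non-constant margin weight is $w^*(g,t)=\min\{w^*(p):\deg(p)\le t,\ g(z)p(z)\ge1\ \forall z\in Z\}$. For $Z'\subseteq Z$, $g|_{Z'}$ denotes the restriction, and these quantities for $g|_{Z'}$ are defined with $Z'$ in place of $Z$.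
   Formalization: Two hypotheses are added since the claim fails without them: every point of $H$ has all coordinates in $[-1,1]$ (else $Y=H=\{-64,64\}$, $f$ = sign, $k=1$, $t=3$ is a counterexample), and $\mathcal{Y}$ is nonempty. *)

theory Defs
  imports "HOL-Analysis.Analysis"
begin

(* Points of R^n are lists of length n, so that viewing Y^k as a subset of R^(m k) is list
   concatenation.  A multilinear polynomial on R^n is its coefficient function S |-> c_S; only
   the values at the subsets S of {..<n} (coordinates are numbered from 0) are ever read. *)
type_synonym mlpoly = "nat set \<Rightarrow> real"

definition chi :: "nat set \<Rightarrow> real list \<Rightarrow> real" where
  "chi S z = (\<Prod>i\<in>S. z ! i)"

definition mleval :: "nat \<Rightarrow> mlpoly \<Rightarrow> real list \<Rightarrow> real" where
  "mleval n c z = (\<Sum>S\<in>Pow {..<n}. c S * chi S z)"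

(* The zero polynomial gets degree 0. *)
definition mldegree :: "nat \<Rightarrow> mlpoly \<Rightarrow> nat" where
  "mldegree n c = Max (insert 0 (card ` {S \<in> Pow {..<n}. c S \<noteq> 0}))"

definition weight :: "nat \<Rightarrow> mlpoly \<Rightarrow> real" where
  "weight n c = (\<Sum>S\<in>Pow {..<n}. \<bar>c S\<bar>)"

definition nonconst_weight :: "nat \<Rightarrow> mlpoly \<Rightarrow> real" where
  "nonconst_weight n c = (\<Sum>S\<in>Pow {..<n} - {{}}. \<bar>c S\<bar>)"

(* Here and below g is read on Z only, so the restriction of g to a subset Z' of its domain
   is obtained by passing Z' for Z. *)
definition is_approx :: "nat \<Rightarrow> real list set \<Rightarrow> real \<Rightarrow> (real list \<Rightarrow> real) \<Rightarrow> mlpoly \<Rightarrow> bool" where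
  "is_approx n Z \<gamma> g c \<longleftrightarrow> (\<forall>z\<in>Z. \<bar>g z - mleval n c z\<bar> \<le> \<gamma>)"

(* The minima are infima in enat and ereal, so a minimum over no polynomial at all is \<infinity>. *)
definition approx_degree :: "nat \<Rightarrow> real list set \<Rightarrow> real \<Rightarrow> (real list \<Rightarrow> real) \<Rightarrow> enat" where
  "approx_degree n Z \<gamma> g = Inf {enat (mldegree n c) | c. is_approx n Z \<gamma> g c}"

definition approx_weight_degree ::
    "nat \<Rightarrow> real list set \<Rightarrow> real \<Rightarrow> real \<Rightarrow> (real list \<Rightarrow> real) \<Rightarrow> enat" where
  "approx_weight_degree n Z \<gamma> W g =
     Inf {enat (mldegree n c) | c. is_approx n Z \<gamma> g c \<and> weight n c \<le> W}"

definition margin_weight :: "nat \<Rightarrow> real list set \<Rightarrow> (real list \<Rightarrow> real) \<Rightarrow> nat \<Rightarrow> ereal" where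
  "margin_weight n Z g t =
     Inf {ereal (nonconst_weight n c) | c. mldegree n c \<le> t \<and> (\<forall>z\<in>Z. g z * mleval n c z \<ge> 1)}"

(* Real powers of elements of [0, \<infinity>], with x^0 = 1 throughout (powr on the reals has
   0 powr 0 = 0). *)
definition epowr :: "ereal \<Rightarrow> real \<Rightarrow> ereal" where
  "epowr x a = (if a = 0 then 1 else if x = \<infinity> then \<infinity> else ereal (real_of_ereal x powr a))"

definition sign_cube :: "nat \<Rightarrow> real list set" where
  "sign_cube k = {x. length x = k \<and> set x \<subseteq> {-1, 1}}"

definition tuples :: "'a set \<Rightarrow> nat \<Rightarrow> 'a list set" where
  "tuples Y k = {ys. length ys = k \<and> set ys \<subseteq> Y}"

end

theory Submission
  imports Defs
begin

text \<open>
  By LP duality, a lower bound \<open>w\<close> on the margin weight of \<open>f\<close> on \<open>H\<close> yields a probability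
  distribution \<open>\<mu>\<close> on \<open>H\<close> under which \<open>f\<close> is balanced and has correlation at most \<open>1 / w\<close> with every
  \<open>\<chi>\<^sub>S\<close>, \<open>1 \<le> |S| \<le> t\<close>. Given an approximation \<open>p\<close> of \<open>G\<close> of degree below \<open>t D / 2\<close>, draw each block
  \<open>Y\<^sub>i\<close> from \<open>\<mu>\<close> conditioned on \<open>f Y\<^sub>i = x\<^sub>i\<close> (so the point stays in \<open>\<Y>\<close>) and take the expectation
  of \<open>p\<close>: this is a polynomial \<open>q\<close> in \<open>x\<close> that approximates \<open>F\<close> within \<open>\<gamma>\<close>. A monomial of \<open>p\<close> meets
  fewer than \<open>D / 2\<close> blocks in more than \<open>t\<close> variables, so it contributes at most \<open>w\<close> to the power
  \<open>- D / 2\<close>, times its own coefficient, to each coefficient of \<open>q\<close> of degree at least \<open>D\<close>. Dropping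
  those coefficients costs at most another \<open>\<gamma>\<close>, which contradicts the degree bound on \<open>F\<close>.
\<close>

section \<open>Solvability of finite systems of linear inequalities\<close>

text \<open>Fourier--Motzkin elimination: every inequality produced by eliminating a variable stays in
  the cone \<open>K\<close>.\<close>

lemma farkas_cone:
  fixes A K :: "(('i \<Rightarrow> real) \<times> real) set"
  assumes "finite I" "finite A" "A \<subseteq> K"
    and "\<And>a b a' b'. (a, b) \<in> K \<Longrightarrow> (a', b') \<in> K \<Longrightarrow> (\<lambda>i. a i + a' i, b + b') \<in> K"
    and "\<And>a b r. (a, b) \<in> K \<Longrightarrow> r \<ge> 0 \<Longrightarrow> (\<lambda>i. r * a i, r * b) \<in> K"
    and "\<And>a b. (a, b) \<in> K \<Longrightarrow> \<forall>i\<in>I. a i = 0 \<Longrightarrow> b \<ge> 0"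
  shows "\<exists>x. \<forall>(a, b)\<in>A. (\<Sum>i\<in>I. a i * x i) \<le> b"
  using assms
proof (induction I arbitrary: A K rule: finite_induct)
  case empty
  then show ?case by auto
next
  case (insert j I)
  \<comment> \<open>For \<open>u\<close> in \<open>P\<close> and \<open>v\<close> in
    \<open>N\<close> the multipliers \<open>- fst v j\<close> and \<open>fst u j\<close> are
    positive, and the coefficient of variable \<open>j\<close> cancels.\<close>
  define elim where "elim u v = ((\<lambda>i. - fst v j * fst u i + fst u j * fst v i),
       - fst v j * snd u + fst u j * snd v)" for u v :: "('i \<Rightarrow> real) \<times> real"
  define P where "P = {u\<in>A. fst u j > 0}"
  define N where "N = {u\<in>A. fst u j < 0}"
  define A' where "A' = {u\<in>A. fst u j = 0} \<union> (\<lambda>(u, v). elim u v) ` (P \<times> N)"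
  \<comment> \<open>Keeping only vectors that vanish at \<open>j\<close> makes vanishing on
    \<open>I\<close> the same as vanishing on \<open>insert j I\<close>, so the sign condition
    passes from \<open>K\<close> to \<open>K'\<close>.\<close>
  define K' where "K' = {u\<in>K. fst u j = 0}"
  have fin: "finite P" "finite N" "finite A'"
    using insert.prems(1) by (auto simp: P_def N_def A'_def)
  have elimK: "elim u v \<in> K'" if "u \<in> P" "v \<in> N" for u v
  proof -
    have "(\<lambda>i. - fst v j * fst u i, - fst v j * snd u) \<in> K"
      using that insert.prems(2) by (intro insert.prems(4)) (auto simp: P_def N_def)
    moreover have "(\<lambda>i. fst u j * fst v i, fst u j * snd v) \<in> K"
      using that insert.prems(2) by (intro insert.prems(4)) (auto simp: P_def N_def)
    ultimately have "elim u v \<in> K"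
      unfolding elim_def by (rule insert.prems(3))
    then show ?thesis by (simp add: K'_def elim_def)
  qed
  have "\<exists>x. \<forall>(a, b)\<in>A'. (\<Sum>i\<in>I. a i * x i) \<le> b"
  proof (rule insert.IH[of A' K'])
    show "A' \<subseteq> K'" using elimK insert.prems(2) by (auto simp: A'_def K'_def)
    show "b \<ge> 0" if "(a, b) \<in> K'" "\<forall>i\<in>I. a i = 0" for a b
      using that insert.prems(5)[of a b] by (auto simp: K'_def)
    show "(\<lambda>i. a i + a' i, b + b') \<in> K'" if "(a, b) \<in> K'" "(a', b') \<in> K'" for a b a' b'
      using that insert.prems(3)[of a b a' b'] by (simp add: K'_def)
    show "(\<lambda>i. r * a i, r * b) \<in> K'" if "(a, b) \<in> K'" "r \<ge> 0" for a b r
      using that insert.prems(4)[of a b r] by (simp add: K'_def)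
  qed (fact fin)
  then obtain x where x: "\<And>u. u \<in> A' \<Longrightarrow> (\<Sum>i\<in>I. fst u i * x i) \<le> snd u"
    by (auto simp: case_prod_beta)
  define s where "s u = (\<Sum>i\<in>I. fst u i * x i)" for u :: "('i \<Rightarrow> real) \<times> real"
  \<comment> \<open>With the other variables fixed to \<open>x\<close>, \<open>bd u\<close> bounds
    variable \<open>j\<close> from above for \<open>u\<close> in \<open>P\<close> and from below for
    \<open>u\<close> in \<open>N\<close>, where dividing by a negative coefficient reverses the
    inequality.\<close>
  define bd where "bd u = (snd u - s u) / fst u j" for u
  have le: "bd v \<le> bd u" if "u \<in> P" "v \<in> N" for u v
  proof -
    have "(\<Sum>i\<in>I. fst (elim u v) i * x i) \<le> snd (elim u v)"
      using that by (intro x) (auto simp: A'_def)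
    then have "- fst v j * s u + fst u j * s v \<le> - fst v j * snd u + fst u j * snd v"
      by (simp add: elim_def s_def sum_distrib_left left_diff_distrib sum_subtractf sum_negf mult.assoc)
    then have "fst u j * (s v - snd v) \<le> - fst v j * (snd u - s u)"
      by (simp add: algebra_simps)
    then have "(s v - snd v) / - fst v j \<le> (snd u - s u) / fst u j"
      using that by (simp add: P_def N_def pos_le_divide_eq pos_divide_le_eq mult.commute del: divide_minus_right)
    moreover have "(s v - snd v) / - fst v j = bd v"
      by (simp add: bd_def diff_divide_distrib)
    ultimately show ?thesis by (simp add: bd_def)
  qed
  obtain z where z: "\<And>u. u \<in> P \<Longrightarrow> z \<le> bd u" "\<And>v. v \<in> N \<Longrightarrow> bd v \<le> z"
  proof (cases "N = {}")
    case True
    show ?thesis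
    proof (cases "P = {}")
      case True
      then show ?thesis using that \<open>N = {}\<close> by auto
    next
      case False
      then show ?thesis using that[of "Min (bd ` P)"] fin \<open>N = {}\<close> by auto
    qed
  next
    case False
    then show ?thesis using that[of "Max (bd ` N)"] fin le by (auto simp: Max_le_iff)
  qed
  have "(\<Sum>i\<in>insert j I. fst u i * (x(j := z)) i) \<le> snd u" if u: "u \<in> A" for u
  proof -
    have "(\<Sum>i\<in>insert j I. fst u i * (x(j := z)) i) = fst u j * z + s u"
      using insert.hyps by (simp add: s_def) (intro sum.cong, auto)
    moreover have "fst u j * z + s u \<le> snd u"
    proof (cases "fst u j" "0 :: real" rule: linorder_cases)
      case less
      then show ?thesis using z(2)[of u] u by (simp add: N_def bd_def field_simps)
    next
      case equal
      then show ?thesis using x[of u] u by (simp add: A'_def s_def)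
    next
      case greater
      then show ?thesis using z(1)[of u] u by (simp add: P_def bd_def field_simps)
    qed
    ultimately show ?thesis by simp
  qed
  then show ?case by (intro exI[of _ "x(j := z)"]) (auto simp: case_prod_beta)
qed

section \<open>Arithmetic of polynomials, weights and degrees\<close>

lemma mleval_add: "mleval n (\<lambda>S. c S + c' S) z = mleval n c z + mleval n c' z"
  by (simp add: mleval_def sum.distrib algebra_simps)

lemma mleval_scale: "mleval n (\<lambda>S. r * c S) z = r * mleval n c z"
  by (simp add: mleval_def sum_distrib_left algebra_simps)

lemma mleval_single:
  assumes "S \<subseteq> {..<n}"
  shows "mleval n (\<lambda>S'. if S' = S then s else 0) z = s * chi S z"
  using assms by (simp add: mleval_def if_distrib [of "\<lambda>x. x * _"] cong: if_cong)

lemma nonconst_weight_add: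
  "nonconst_weight n (\<lambda>S. c S + c' S) \<le> nonconst_weight n c + nonconst_weight n c'"
  unfolding nonconst_weight_def sum.distrib [symmetric] by (intro sum_mono) auto

lemma nonconst_weight_scale: "nonconst_weight n (\<lambda>S. r * c S) = \<bar>r\<bar> * nonconst_weight n c"
  by (simp add: nonconst_weight_def sum_distrib_left abs_mult)

lemma nonconst_weight_single:
  assumes "S \<subseteq> {..<n}"
  shows "nonconst_weight n (\<lambda>S'. if S' = S then s else 0) = (if S = {} then 0 else \<bar>s\<bar>)"
  using assms by (simp add: nonconst_weight_def if_distrib [of abs] cong: if_cong)

lemma nonconst_weight_nonneg: "nonconst_weight n c \<ge> 0"
  by (simp add: nonconst_weight_def sum_nonneg)

lemma mldegree_le_iff: "mldegree n c \<le> t \<longleftrightarrow> (\<forall>S\<subseteq>{..<n}. c S \<noteq> 0 \<longrightarrow> card S \<le> t)"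
  unfolding mldegree_def by (subst Max_le_iff) auto

lemma margin_weight_le:
  assumes "mldegree n c \<le> t" "\<forall>z\<in>Z. g z * mleval n c z \<ge> 1"
  shows "margin_weight n Z g t \<le> ereal (nonconst_weight n c)"
  unfolding margin_weight_def using assms by (intro Inf_lower) auto

section \<open>Linear programming duality for the margin weight\<close>

text \<open>If the system \<open>A\<close> for \<open>\<mu>\<close> were infeasible, a nonnegative
  combination of its rows would vanish on \<open>H\<close> with negative right-hand side. The
  multipliers of the correlation rows then form a polynomial of degree at most \<open>t\<close>
  that, rescaled, has margin 1 and non-constant weight below \<open>w\<close>, against the
  hypothesis on \<open>w\<close>.\<close>

lemma margin_weight_dual:
  assumes "finite H" "w > 0" and w: "ereal w \<le> margin_weight n H f t"
  obtains \<mu> where "\<And>y. y \<in> H \<Longrightarrow> \<mu> y \<ge> 0" "sum \<mu> H = 1" "(\<Sum>y\<in>H. \<mu> y * f y) = 0"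
    and "\<And>S. S \<subseteq> {..<n} \<Longrightarrow> S \<noteq> {} \<Longrightarrow> card S \<le> t \<Longrightarrow> \<bar>\<Sum>y\<in>H. \<mu> y * f y * chi S y\<bar> \<le> 1 / w"
proof -
  define P where "P = {S. S \<subseteq> {..<n} \<and> card S \<le> t}"
  \<comment> \<open>The bound 0 at \<open>S = {}\<close>, imposed for both signs \<open>s\<close>,
    encodes exact balance of \<open>f\<close> under \<open>\<mu>\<close>.\<close>
  define test where
    "test s S = ((\<lambda>y. s * (f y * chi S y)), if S = {} then 0 else 1 / w)" for s :: real and S
  define A where "A = (\<lambda>y. (\<lambda>y'. if y' = y then - 1 else 0, 0)) ` H
    \<union> {(\<lambda>_. 1, 1), (\<lambda>_. - 1, - 1)} \<union> (\<lambda>(s, S). test s S) ` ({1, - 1} \<times> P)"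
  define cert where "cert a b c \<rho> \<longleftrightarrow> (\<forall>S. c S \<noteq> 0 \<longrightarrow> S \<in> P)
      \<and> (\<forall>y\<in>H. a y \<le> \<rho> + f y * mleval n c y) \<and> \<rho> + nonconst_weight n c / w \<le> b" for a b c \<rho>
  \<comment> \<open>\<open>K\<close> over-approximates the cone spanned by \<open>A\<close>: the polynomial \<open>c\<close> collects the multipliers
    of the correlation constraints and \<open>\<rho>\<close> that of the normalisation of \<open>\<mu>\<close>.\<close>
  define K where "K = {(a, b). \<exists>c \<rho>. cert a b c \<rho>}"
  have fP: "finite P" by (rule finite_subset[of _ "Pow {..<n}"]) (auto simp: P_def)
  have "\<exists>\<mu>. \<forall>(a, b)\<in>A. (\<Sum>y\<in>H. a y * \<mu> y) \<le> b"
  proof (rule farkas_cone[of H A K])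
    show "finite A" using assms(1) fP by (auto simp: A_def)
    show "A \<subseteq> K"
    proof -
      have "(\<lambda>y'. if y' = y then - 1 else 0, 0) \<in> K" for y
        unfolding K_def mem_Collect_eq case_prod_conv
        by (intro exI[of _ "\<lambda>_. 0"] exI[of _ 0])
          (simp add: cert_def mleval_def nonconst_weight_def)
      moreover have "(\<lambda>_. r, r) \<in> K" for r
        unfolding K_def mem_Collect_eq case_prod_conv
        by (intro exI[of _ "\<lambda>_. 0"] exI[of _ r])
          (simp add: cert_def mleval_def nonconst_weight_def)
      moreover have "test s S \<in> K" if "S \<in> P" "\<bar>s\<bar> = 1" for s S
        unfolding K_def test_def mem_Collect_eq case_prod_conv
        using that
        by (intro exI[of _ "\<lambda>S'. if S' = S then s else 0"] exI[of _ 0])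
          (auto simp: cert_def mleval_single nonconst_weight_single P_def)
      ultimately show ?thesis unfolding A_def by auto
    qed
    show "(\<lambda>i. a i + a' i, b + b') \<in> K" if "(a, b) \<in> K" "(a', b') \<in> K" for a b a' b'
    proof -
      from that obtain c \<rho> c' \<rho>' where c: "cert a b c \<rho>" "cert a' b' c' \<rho>'" by (auto simp: K_def)
      have "nonconst_weight n (\<lambda>S. c S + c' S) / w \<le> nonconst_weight n c / w + nonconst_weight n c' / w"
        using nonconst_weight_add[of n c c'] \<open>w > 0\<close> by (simp add: field_simps)
      then have "cert (\<lambda>i. a i + a' i) (b + b') (\<lambda>S. c S + c' S) (\<rho> + \<rho>')"
        using c unfolding cert_def mleval_add distrib_left
      proof (intro conjI allI ballI impI, goal_cases)
        case (1 S)
        then show ?case by (cases "c S = 0") auto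
      next
        case (2 y)
        then show ?case by (smt (verit))
      next
        case 3
        then show ?case by linarith
      qed
      then show ?thesis by (auto simp: K_def)
    qed
    show "(\<lambda>i. r * a i, r * b) \<in> K" if "(a, b) \<in> K" "r \<ge> 0" for a b r
    proof -
      from that obtain c \<rho> where c: "cert a b c \<rho>" by (auto simp: K_def)
      have "r * a y \<le> r * \<rho> + f y * (r * mleval n c y)" if "y \<in> H" for y
        using mult_left_mono[OF _ \<open>r \<ge> 0\<close>, of "a y" "\<rho> + f y * mleval n c y"] c that
        by (simp add: cert_def algebra_simps)
      moreover have "r * \<rho> + r * nonconst_weight n c / w \<le> r * b"
        using mult_left_mono[OF _ \<open>r \<ge> 0\<close>, of "\<rho> + nonconst_weight n c / w" b] c
        by (simp add: cert_def algebra_simps)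
      ultimately have "cert (\<lambda>i. r * a i) (r * b) (\<lambda>S. r * c S) (r * \<rho>)"
        using c \<open>r \<ge> 0\<close> by (simp add: cert_def mleval_scale nonconst_weight_scale)
      then show ?thesis by (auto simp: K_def)
    qed
    show "b \<ge> 0" if ab: "(a, b) \<in> K" "\<forall>y\<in>H. a y = 0" for a b
    proof (rule ccontr)
      assume "\<not> b \<ge> 0"
      from ab obtain c \<rho> where c: "cert a b c \<rho>" by (auto simp: K_def)
      have neg: "\<rho> + nonconst_weight n c / w < 0" using c \<open>\<not> b \<ge> 0\<close> by (simp add: cert_def)
      then have "\<rho> < 0"
        using nonconst_weight_nonneg[of n c] \<open>w > 0\<close> by (smt (verit) divide_nonneg_pos)
      \<comment> \<open>As \<open>a\<close> vanishes on \<open>H\<close>, the certificate says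
        \<open>f y * mleval n c y \<ge> - \<rho>\<close> with \<open>- \<rho> > 0\<close>; dividing
        by \<open>- \<rho>\<close> normalises the margin to 1.\<close>
      let ?c = "\<lambda>S. (1 / - \<rho>) * c S"
      have "mldegree n ?c \<le> t" using c by (auto simp: mldegree_le_iff cert_def P_def)
      moreover have "f y * mleval n ?c y \<ge> 1" if "y \<in> H" for y
      proof -
        have "- \<rho> \<le> f y * mleval n c y" using c ab that by (auto simp: cert_def)
        then show ?thesis using \<open>\<rho> < 0\<close> unfolding mleval_scale by (simp add: field_simps)
      qed
      ultimately have "ereal w \<le> ereal (nonconst_weight n ?c)"
        using margin_weight_le[of n ?c t H f] w by (meson order_trans)
      moreover have "nonconst_weight n ?c < w"
        using neg \<open>\<rho> < 0\<close> \<open>w > 0\<close> unfolding nonconst_weight_scale by (simp add: field_simps)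
      ultimately show False by simp
    qed
  qed (use assms in auto)
  then obtain \<mu> where \<mu>: "\<And>a b. (a, b) \<in> A \<Longrightarrow> (\<Sum>y\<in>H. a y * \<mu> y) \<le> b" by auto
  have t: "s * (\<Sum>y\<in>H. \<mu> y * f y * chi S y) \<le> (if S = {} then 0 else 1 / w)"
    if "S \<in> P" "s \<in> {1, -1}" for s S
  proof -
    have "test s S \<in> A" using that by (force simp: A_def)
    then have "(\<Sum>y\<in>H. s * (f y * chi S y) * \<mu> y) \<le> (if S = {} then 0 else 1 / w)"
      unfolding test_def by (rule \<mu>)
    then show ?thesis by (simp add: sum_distrib_left algebra_simps)
  qed
  show thesis
  proof
    show "\<mu> y \<ge> 0" if "y \<in> H" for y
    proof -
      have "(\<Sum>y'\<in>H. (if y' = y then - 1 else 0) * \<mu> y') \<le> 0"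
        using that by (intro \<mu>) (auto simp: A_def)
      then show ?thesis
        using that \<open>finite H\<close> by (simp add: if_distrib [of "\<lambda>x. x * _"] cong: if_cong)
    qed
    show "sum \<mu> H = 1"
      using \<mu>[of "\<lambda>_. 1" 1] \<mu>[of "\<lambda>_. - 1" "- 1"] by (simp add: A_def sum_negf)
    show "(\<Sum>y\<in>H. \<mu> y * f y) = 0"
      using t[of "{}" 1] t[of "{}" "- 1"] by (simp add: P_def chi_def)
    show "\<bar>\<Sum>y\<in>H. \<mu> y * f y * chi S y\<bar> \<le> 1 / w"
      if "S \<subseteq> {..<n}" "S \<noteq> {}" "card S \<le> t" for S
      using t[of S 1] t[of S "- 1"] that by (simp add: P_def abs_le_iff)
  qed
qed

section \<open>Monomials on concatenated blocks\<close>

definition block :: "nat \<Rightarrow> nat set \<Rightarrow> nat \<Rightarrow> nat set" where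
  "block n S i = {j. j < n \<and> i * n + j \<in> S}"

lemma block_subset: "block n S i \<subseteq> {..<n}"
  by (auto simp: block_def)

lemma finite_block [simp]: "finite (block n S i)"
  using finite_subset[OF block_subset] by blast

text \<open>Division with remainder by \<open>n\<close> recovers the block index and the offset in
  the block.\<close>

lemma bij_betw_blocks:
  assumes "S \<subseteq> {..<k * n}"
  shows "bij_betw (\<lambda>(i, j). i * n + j) (SIGMA i:{..<k}. block n S i) S"
proof (rule bij_betw_byWitness[where f' = "\<lambda>s. (s div n, s mod n)"])
  show "(\<lambda>s. (s div n, s mod n)) ` S \<subseteq> (SIGMA i:{..<k}. block n S i)"
  proof clarify
    fix s assume s: "s \<in> S"
    then have "s < k * n" using assms by auto
    then have "n > 0" by (cases n) auto
    then show "s div n \<in> {..<k} \<and> s mod n \<in> block n S (s div n)"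
      using s \<open>s < k * n\<close> by (simp add: block_def less_mult_imp_div_less)
  qed
qed (auto simp: block_def)

lemma card_blocks:
  assumes "S \<subseteq> {..<k * n}"
  shows "(\<Sum>i<k. card (block n S i)) = card S"
  using bij_betw_same_card[OF bij_betw_blocks[OF assms]] by simp

lemma concat_nth:
  assumes "\<forall>y\<in>set ys. length y = n" "i < length ys" "j < n"
  shows "concat ys ! (i * n + j) = ys ! i ! j"
  using assms
proof (induction ys arbitrary: i)
  case (Cons y ys)
  then show ?case by (cases i) (auto simp: nth_append)
qed simp

text \<open>This factorisation turns the expectation of a monomial over independently drawn blocks
  into a product of block expectations.\<close>

lemma chi_concat:
  assumes "\<forall>y\<in>set ys. length y = n" "length ys = k" "S \<subseteq> {..<k * n}"
  shows "chi S (concat ys) = (\<Prod>i<k. chi (block n S i) (ys ! i))"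
proof -
  have "chi S (concat ys) = (\<Prod>(i, j)\<in>(SIGMA i:{..<k}. block n S i). concat ys ! (i * n + j))"
    unfolding chi_def
    by (subst prod.reindex_bij_betw[OF bij_betw_blocks[OF assms(3)], symmetric])
      (simp add: case_prod_beta)
  also have "\<dots> = (\<Prod>i<k. \<Prod>j\<in>block n S i. concat ys ! (i * n + j))"
    by (rule prod.Sigma[symmetric]) auto
  also have "\<dots> = (\<Prod>i<k. chi (block n S i) (ys ! i))"
    unfolding chi_def using assms
    by (intro prod.cong refl concat_nth) (auto simp: block_def)
  finally show ?thesis .
qed

section \<open>Bounds on monomials and on products of block correlations\<close>

lemma abs_chi_le_1:
  assumes "S \<subseteq> {..<length y}" "\<forall>a\<in>set y. \<bar>a\<bar> \<le> 1"
  shows "\<bar>chi S y\<bar> \<le> 1"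
  unfolding chi_def abs_prod using assms by (intro prod_le_1) auto

text \<open>A Markov-type count: fewer than \<open>D / 2\<close> indices can have
  \<open>m i > t\<close>, so at least \<open>D / 2\<close> of the factors are bounded by
  \<open>s\<close> and the rest by 1.\<close>

lemma abs_prod_le_powr:
  fixes b :: "'a \<Rightarrow> real" and m :: "'a \<Rightarrow> nat"
  assumes "finite T" "\<And>i. i \<in> T \<Longrightarrow> \<bar>b i\<bar> \<le> 1" "\<And>i. i \<in> T \<Longrightarrow> m i \<le> t \<Longrightarrow> \<bar>b i\<bar> \<le> s"
    and "0 < s" "s \<le> 1" "D \<le> card T" "2 * (\<Sum>i\<in>T. m i) < t * D"
  shows "\<bar>\<Prod>i\<in>T. b i\<bar> \<le> s powr (real D / 2)"
proof -
  define B where "B = {i\<in>T. t < m i}"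
  have "card B * t \<le> (\<Sum>i\<in>B. m i)"
    using sum_mono[of B "\<lambda>_. t" m] by (auto simp: B_def)
  also have "\<dots> \<le> (\<Sum>i\<in>T. m i)" using assms(1) by (intro sum_mono2) (auto simp: B_def)
  finally have "2 * (card B * t) < t * D" using assms(7) by linarith
  then have B: "2 * card B < D" by (simp add: mult.left_commute mult.commute[of "card B"])
  have cd: "card (T - B) = card T - card B" using assms(1)
    by (intro card_Diff_subset) (auto simp: B_def)
  have "\<bar>\<Prod>i\<in>T. b i\<bar> \<le> (\<Prod>i\<in>T. if i \<in> B then 1 else s)"
    unfolding abs_prod using assms(2,3) by (intro prod_mono) (auto simp: B_def)
  also have "\<dots> = s ^ card (T - B)"
    using assms(1) by (simp add: prod.If_cases Diff_eq)
  also have "\<dots> = s powr real (card (T - B))" using \<open>0 < s\<close> by (simp add: powr_realpow)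
  \<comment> \<open>Powers of \<open>s\<close> decrease in the exponent because
    \<open>s \<le> 1\<close>.\<close>
  also have "\<dots> \<le> s powr (real D / 2)"
    using assms(4-6) B cd by (intro powr_mono') auto
  finally show ?thesis .
qed

section \<open>Averaging an approximation over conditioned blocks, and truncation\<close>

text \<open>For \<open>f y, x \<in> {-1, 1}\<close> the weight \<open>\<mu> y * (1 + f y * x)\<close> is the balanced distribution \<open>\<mu>\<close>
  conditioned on \<open>f y = x\<close>.\<close>

lemma block_expectation_approx:
  fixes \<mu> f F :: "real list \<Rightarrow> real" and H :: "real list set"
  defines "a \<equiv> \<lambda>S. \<Sum>y\<in>H. \<mu> y * chi S y" and "b \<equiv> \<lambda>S. \<Sum>y\<in>H. \<mu> y * f y * chi S y"
  assumes "finite H" "\<forall>y\<in>H. length y = n" "\<forall>y\<in>H. f y \<in> {-1, 1}"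
    and "\<And>y. y \<in> H \<Longrightarrow> \<mu> y \<ge> 0" "sum \<mu> H = 1" "(\<Sum>y\<in>H. \<mu> y * f y) = 0"
    and appr: "\<And>ys. ys \<in> tuples H k \<Longrightarrow> \<bar>F (map f ys) - mleval (k * n) c (concat ys)\<bar> \<le> \<gamma>"
    and x: "x \<in> sign_cube k"
  shows "\<bar>F x - (\<Sum>S\<in>Pow {..<k * n}. c S * (\<Prod>i<k. b (block n S i) * x ! i + a (block n S i)))\<bar> \<le> \<gamma>"
proof -
  \<comment> \<open>Tuples are indexed by extensional functions so that a product of sums over
    \<open>H\<close> expands into a sum over \<open>X\<close>; \<open>tup\<close> converts back to
    lists.\<close>
  define X where "X = PiE {..<k} (\<lambda>_. H)"
  define tup where "tup g = map g [0..<k]" for g :: "nat \<Rightarrow> real list"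
  define \<nu> where "\<nu> i y = \<mu> y * (1 + f y * x ! i)" for i y
  define wt where "wt g = (\<Prod>i<k. \<nu> i (g i))" for g
  have xi: "x ! i \<in> {-1, 1}" if "i < k" for i
    using x that nth_mem[of i x] unfolding sign_cube_def by blast
  have gH: "g i \<in> H" if "g \<in> X" "i < k" for g i
    using that PiE_mem[of g "{..<k}" "\<lambda>_. H" i] by (simp add: X_def)
  have tupX: "tup g \<in> tuples H k" if "g \<in> X" for g
    using gH[OF that] by (auto simp: tup_def tuples_def)
  have wt_nonneg: "wt g \<ge> 0" if "g \<in> X" for g
    unfolding wt_def \<nu>_def
  proof (intro prod_nonneg ballI mult_nonneg_nonneg)
    fix i assume "i \<in> {..<k}"
    then have i: "g i \<in> H" "x ! i \<in> {-1, 1}" using gH[OF that] xi by simp_all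
    then show "\<mu> (g i) \<ge> 0" by (intro assms(6))
    have "f (g i) \<in> {-1, 1}" using i assms(5) by blast
    then show "1 + f (g i) * x ! i \<ge> 0" using i(2) by auto
  qed
  \<comment> \<open>The total mass factors over the blocks; normalisation and balance of
    \<open>\<mu>\<close> make every factor 1, whatever \<open>x\<close> is.\<close>
  have "(\<Sum>g\<in>X. wt g) = (\<Prod>i<k. \<Sum>y\<in>H. \<nu> i y)"
    unfolding wt_def X_def using assms(3) by (intro prod_sum_PiE[symmetric]) auto
  also have "\<dots> = (\<Prod>i<k. sum \<mu> H + x ! i * (\<Sum>y\<in>H. \<mu> y * f y))"
    by (simp add: \<nu>_def sum.distrib sum_distrib_left algebra_simps)
  finally have wt_sum: "(\<Sum>g\<in>X. wt g) = 1" by (simp add: assms)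
  \<comment> \<open>Each block contributes a function affine in \<open>x ! i\<close>: its slope is
    the correlation with \<open>f\<close>, its constant term the plain mean.\<close>
  have chi_exp: "(\<Sum>g\<in>X. wt g * chi S (concat (tup g)))
      = (\<Prod>i<k. b (block n S i) * x ! i + a (block n S i))" if "S \<subseteq> {..<k * n}" for S
  proof -
    have "chi S (concat (tup g)) = (\<Prod>i<k. chi (block n S i) (g i))" if g: "g \<in> X" for g
    proof -
      have "chi S (concat (tup g)) = (\<Prod>i<k. chi (block n S i) (tup g ! i))"
        using tupX[OF g] assms(4) \<open>S \<subseteq> {..<k * n}\<close>
        by (intro chi_concat) (auto simp: tuples_def)
      then show ?thesis by (simp add: tup_def)
    qed
    then have "(\<Sum>g\<in>X. wt g * chi S (concat (tup g)))
        = (\<Sum>g\<in>X. \<Prod>i<k. \<nu> i (g i) * chi (block n S i) (g i))"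
      by (simp add: wt_def prod.distrib)
    also have "\<dots> = (\<Prod>i<k. \<Sum>y\<in>H. \<nu> i y * chi (block n S i) y)"
      unfolding X_def using assms(3) by (intro prod_sum_PiE[symmetric]) auto
    also have "\<dots> = (\<Prod>i<k. b (block n S i) * x ! i + a (block n S i))"
      unfolding a_def b_def \<nu>_def sum_distrib_right sum.distrib[symmetric]
      by (intro prod.cong sum.cong refl) (simp add: algebra_simps)
    finally show ?thesis .
  qed
  let ?q = "\<Sum>S\<in>Pow {..<k * n}. c S * (\<Prod>i<k. b (block n S i) * x ! i + a (block n S i))"
  have "?q = (\<Sum>S\<in>Pow {..<k * n}. \<Sum>g\<in>X. wt g * (c S * chi S (concat (tup g))))"
  proof (intro sum.cong refl)
    fix S assume "S \<in> Pow {..<k * n}"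
    then have "c S * (\<Prod>i<k. b (block n S i) * x ! i + a (block n S i))
        = c S * (\<Sum>g\<in>X. wt g * chi S (concat (tup g)))"
      using chi_exp[of S] by simp
    then show "c S * (\<Prod>i<k. b (block n S i) * x ! i + a (block n S i))
        = (\<Sum>g\<in>X. wt g * (c S * chi S (concat (tup g))))"
      by (simp add: sum_distrib_left mult.left_commute)
  qed
  also have "\<dots> = (\<Sum>g\<in>X. wt g * mleval (k * n) c (concat (tup g)))"
    unfolding mleval_def sum_distrib_left by (rule sum.swap)
  finally have "F x - ?q = (\<Sum>g\<in>X. wt g * (F x - mleval (k * n) c (concat (tup g))))"
    using wt_sum by (simp add: right_diff_distrib sum_subtractf flip: sum_distrib_right)
  also have "\<bar>\<dots>\<bar> \<le> (\<Sum>g\<in>X. wt g * \<gamma>)"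
  proof (rule order_trans[OF sum_abs], rule sum_mono)
    fix g assume g: "g \<in> X"
    show "\<bar>wt g * (F x - mleval (k * n) c (concat (tup g)))\<bar> \<le> wt g * \<gamma>"
    proof (cases "wt g = 0")
      case False
      \<comment> \<open>Nonzero weight means that no factor \<open>1 + f (g i) * x ! i\<close>
        vanishes, which for signs forces equality.\<close>
      have "f (g i) = x ! i" if "i < k" for i
      proof -
        have "1 + f (g i) * x ! i \<noteq> 0" using False that by (auto simp: wt_def \<nu>_def)
        moreover have "f (g i) \<in> {-1, 1}" using gH[OF g that] assms(5) by blast
        ultimately show ?thesis using xi[OF that] by auto
      qed
      then have "map f (tup g) = x"
        using x by (intro nth_equalityI) (auto simp: tup_def sign_cube_def)
      then show ?thesis
        using appr[OF tupX[OF g]] wt_nonneg[OF g] by (simp add: abs_mult mult_left_mono)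
    qed simp
  qed
  also have "\<dots> = \<gamma>" using wt_sum by (simp flip: sum_distrib_right)
  finally show ?thesis .
qed

text \<open>Averaging costs no accuracy, and the coefficients of degree at least \<open>D\<close>
  are so small that deleting them costs at most another \<open>\<gamma>\<close>; the hypothesis on
  \<open>weight\<close> is exactly this budget. The resulting \<open>c'\<close> will contradict the
  minimality of \<open>D\<close>.\<close>

lemma truncated_expectation_approx:
  fixes f F :: "real list \<Rightarrow> real"
  assumes "finite H" "\<forall>y\<in>H. length y = n" "\<forall>y\<in>H. f y \<in> {-1, 1}"
    and "\<forall>y\<in>H. \<forall>a\<in>set y. \<bar>a\<bar> \<le> 1"
    and appr: "\<And>ys. ys \<in> tuples H k \<Longrightarrow> \<bar>F (map f ys) - mleval (k * n) c (concat ys)\<bar> \<le> \<gamma>"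
    and "w > 0" "ereal w \<le> margin_weight n H f t"
    and W: "2 ^ k * weight (k * n) c \<le> \<gamma> * w powr (real D / 2)"
    and deg: "2 * mldegree (k * n) c < t * D"
  obtains c' where "mldegree k c' < D" "is_approx k (sign_cube k) (2 * \<gamma>) F c'"
proof -
  obtain \<mu> where \<mu>: "\<And>y. y \<in> H \<Longrightarrow> \<mu> y \<ge> 0" "sum \<mu> H = 1" "(\<Sum>y\<in>H. \<mu> y * f y) = 0"
    and corr: "\<And>S. S \<subseteq> {..<n} \<Longrightarrow> S \<noteq> {} \<Longrightarrow> card S \<le> t
      \<Longrightarrow> \<bar>\<Sum>y\<in>H. \<mu> y * f y * chi S y\<bar> \<le> 1 / w"
    using margin_weight_dual[OF assms(1,6,7)] by metis
  define a where "a = (\<lambda>S. \<Sum>y\<in>H. \<mu> y * chi S y)"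
  define b where "b = (\<lambda>S. \<Sum>y\<in>H. \<mu> y * f y * chi S y)"
  \<comment> \<open>\<open>w\<close> may be less than 1, while \<open>abs_prod_le_powr\<close> needs
    a bound of at most 1; the trivial bound \<open>b1\<close> covers that case.\<close>
  define s where "s = min 1 (1 / w)"
  have s: "0 < s" "s \<le> 1" "s \<le> 1 / w" using \<open>w > 0\<close> by (auto simp: s_def)
  have chi1: "\<bar>chi S y\<bar> \<le> 1" if "S \<subseteq> {..<n}" "y \<in> H" for S y
    using assms(2,4) that by (intro abs_chi_le_1) auto
  have sum1: "\<bar>\<Sum>y\<in>H. \<mu> y * h y\<bar> \<le> 1" if "\<And>y. y \<in> H \<Longrightarrow> \<bar>h y\<bar> \<le> 1" for h
  proof -
    have "\<bar>\<Sum>y\<in>H. \<mu> y * h y\<bar> \<le> (\<Sum>y\<in>H. \<mu> y)"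
      using that \<mu>(1) by (intro order_trans[OF sum_abs] sum_mono) (simp add: abs_mult mult_left_le)
    then show ?thesis using \<mu>(2) by simp
  qed
  have a1: "\<bar>a S\<bar> \<le> 1" if "S \<subseteq> {..<n}" for S
    unfolding a_def using chi1 that by (intro sum1) auto
  have b1: "\<bar>b S\<bar> \<le> 1" if "S \<subseteq> {..<n}" for S
    unfolding b_def mult.assoc
  proof (intro sum1)
    fix y assume "y \<in> H"
    then have "\<bar>f y\<bar> = 1" using assms(3) by auto
    then show "\<bar>f y * chi S y\<bar> \<le> 1" using chi1[OF that \<open>y \<in> H\<close>] by (simp add: abs_mult)
  qed
  \<comment> \<open>\<open>corr\<close> says nothing about the empty set; there balance gives
    \<open>b {} = 0\<close>.\<close>
  have bs: "\<bar>b S\<bar> \<le> s" if "S \<subseteq> {..<n}" "card S \<le> t" for S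
  proof (cases "S = {}")
    case True
    then show ?thesis using \<mu>(3) s by (simp add: b_def chi_def)
  next
    case False
    then show ?thesis using corr[OF that(1) False that(2)] b1[OF that(1)] by (simp add: s_def b_def)
  qed
  \<comment> \<open>Coefficient of \<open>chi T\<close> after multiplying out: blocks in
    \<open>T\<close> supply their linear term, the others their constant term.\<close>
  define e where "e T = (\<Sum>S\<in>Pow {..<k * n}. c S *
      ((\<Prod>i\<in>T. b (block n S i)) * (\<Prod>i\<in>{..<k} - T. a (block n S i))))" for T
  define c' where "c' T = (if card T < D then e T else 0)" for T
  have "D > 0" using deg by (cases D) auto
  then have "mldegree k c' \<le> D - 1" by (auto simp: mldegree_le_iff c'_def split: if_splits)
  then have "mldegree k c' < D" using \<open>D > 0\<close> by simp
  moreover have "is_approx k (sign_cube k) (2 * \<gamma>) F c'"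
    unfolding is_approx_def
  proof
    fix x assume x: "x \<in> sign_cube k"
    have chix: "\<bar>chi T x\<bar> \<le> 1" if "T \<subseteq> {..<k}" for T
      using x that by (intro abs_chi_le_1) (auto simp: sign_cube_def)
    have "(\<Sum>S\<in>Pow {..<k * n}. c S * (\<Prod>i<k. b (block n S i) * x ! i + a (block n S i)))
        = (\<Sum>S\<in>Pow {..<k * n}. \<Sum>T\<in>Pow {..<k}. c S *
            ((\<Prod>i\<in>T. b (block n S i)) * (\<Prod>i\<in>{..<k} - T. a (block n S i))) * chi T x)"
      by (simp add: prod_add prod.distrib chi_def sum_distrib_left mult_ac)
    also have "\<dots> = mleval k e x"
      unfolding mleval_def e_def sum_distrib_right by (rule sum.swap)
    finally have "\<bar>F x - mleval k e x\<bar> \<le> \<gamma>"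
      using block_expectation_approx[OF assms(1-3) \<mu> appr x] by (simp add: a_def b_def)
    moreover have "\<bar>mleval k e x - mleval k c' x\<bar> \<le> \<gamma>"
    proof -
      have e: "\<bar>e T - c' T\<bar> \<le> weight (k * n) c * s powr (real D / 2)" if T: "T \<subseteq> {..<k}" for T
      proof (cases "card T < D")
        case True
        then show ?thesis by (simp add: c'_def weight_def sum_nonneg)
      next
        case False
        have "\<bar>e T\<bar> \<le> (\<Sum>S\<in>Pow {..<k * n}. \<bar>c S\<bar> * s powr (real D / 2))"
          unfolding e_def
        proof (rule order_trans[OF sum_abs], rule sum_mono)
          fix S assume S: "S \<in> Pow {..<k * n}"
          show "\<bar>c S * ((\<Prod>i\<in>T. b (block n S i)) * (\<Prod>i\<in>{..<k} - T. a (block n S i)))\<bar>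
              \<le> \<bar>c S\<bar> * s powr (real D / 2)"
          proof (cases "c S = 0")
            case False
            have "(\<Sum>i\<in>T. card (block n S i)) \<le> (\<Sum>i<k. card (block n S i))"
              using T by (intro sum_mono2) auto
            also have "\<dots> = card S" using S by (intro card_blocks) auto
            also have "\<dots> \<le> mldegree (k * n) c"
              using mldegree_le_iff[of "k * n" c "mldegree (k * n) c"] S False by auto
            finally have "2 * (\<Sum>i\<in>T. card (block n S i)) < t * D" using deg by simp
            then have "\<bar>\<Prod>i\<in>T. b (block n S i)\<bar> \<le> s powr (real D / 2)"
              using T \<open>\<not> card T < D\<close> s b1[OF block_subset] bs[OF block_subset]
              by (intro abs_prod_le_powr[where m = "\<lambda>i. card (block n S i)" and t = t])
                (auto intro: finite_subset)
            moreover have "\<bar>\<Prod>i\<in>{..<k} - T. a (block n S i)\<bar> \<le> 1"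
              unfolding abs_prod using a1[OF block_subset] by (intro prod_le_1) auto
            ultimately have "\<bar>\<Prod>i\<in>T. b (block n S i)\<bar> * \<bar>\<Prod>i\<in>{..<k} - T. a (block n S i)\<bar>
                \<le> s powr (real D / 2) * 1"
              by (intro mult_mono) auto
            then show ?thesis by (simp add: abs_mult mult_left_mono)
          qed simp
        qed
        then show ?thesis using False by (simp add: c'_def weight_def sum_distrib_right)
      qed
      have "\<bar>mleval k e x - mleval k c' x\<bar> = \<bar>\<Sum>T\<in>Pow {..<k}. (e T - c' T) * chi T x\<bar>"
        by (simp add: mleval_def left_diff_distrib sum_subtractf)
      also have "\<dots> \<le> (\<Sum>T\<in>Pow {..<k}. weight (k * n) c * s powr (real D / 2))"
      proof (rule order_trans[OF sum_abs], rule sum_mono)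
        fix T assume "T \<in> Pow {..<k}"
        then have "\<bar>(e T - c' T) * chi T x\<bar> \<le> weight (k * n) c * s powr (real D / 2) * 1"
          unfolding abs_mult using e chix by (intro mult_mono) (auto intro: order_trans[OF abs_ge_zero])
        then show "\<bar>(e T - c' T) * chi T x\<bar> \<le> weight (k * n) c * s powr (real D / 2)" by simp
      qed
      \<comment> \<open>The factor \<open>2 ^ k\<close> counts the sets \<open>T\<close> and is
        absorbed by the budget \<open>W\<close>; bounding \<open>s\<close> by \<open>1 / w\<close>
        then cancels the power of \<open>w\<close>.\<close>
      also have "\<dots> = 2 ^ k * weight (k * n) c * s powr (real D / 2)"
        by (simp add: card_Pow)
      also have "\<dots> \<le> 2 ^ k * weight (k * n) c * (1 / w) powr (real D / 2)"
        using s by (intro mult_left_mono powr_mono2) (auto simp: weight_def sum_nonneg)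
      also have "\<dots> \<le> \<gamma> * w powr (real D / 2) * (1 / w) powr (real D / 2)"
        using W by (intro mult_right_mono) auto
      also have "\<dots> = \<gamma>" using \<open>w > 0\<close> by (simp add: powr_divide)
      finally show ?thesis .
    qed
    ultimately show "\<bar>F x - mleval k c' x\<bar> \<le> 2 * \<gamma>" by linarith
  qed
  ultimately show thesis by (rule that)
qed

section \<open>The degree bound for the composed function\<close>

theorem theorem5p1:
  fixes d k t D :: nat
    and Y H \<Y> :: "real list set"
    and \<gamma> W :: real
    and f F G :: "real list \<Rightarrow> real"
  assumes "d > 0" and "k > 0" and "k dvd d"
    and "finite Y" and "\<forall>y\<in>Y. length y = d div k"
    and "\<gamma> > 0"
    and "\<forall>y\<in>Y. f y \<in> {-1, 1}"
    and "\<forall>x\<in>sign_cube k. F x \<in> {-1, 1}"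
    and "approx_degree k (sign_cube k) (2 * \<gamma>) F = enat D"
    and "\<forall>ys\<in>tuples Y k. G (concat ys) = F (map f ys)"
    and "\<Y> \<subseteq> concat ` tuples Y k"
    and "\<Y> \<noteq> {}"
    and "H \<subseteq> Y"
    and "\<forall>y\<in>H. \<forall>a\<in>set y. \<bar>a\<bar> \<le> 1"
    and "\<forall>ys\<in>tuples Y k. concat ys \<notin> \<Y> \<longrightarrow> (\<exists>i<k. ys ! i \<in> Y - H)"
    and "t > 0"
    and "ereal W \<le> ereal (\<gamma> * 2 powr - real k) * epowr (margin_weight (d div k) H f t) (real D / 2)"
  shows "ereal_of_enat (approx_weight_degree d \<Y> \<gamma> W G) \<ge> ereal (real t * real D / 2)"
proof -
  define n where "n = d div k"
  define M where "M = margin_weight n H f t"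
  have d: "d = k * n" using assms(3) by (simp add: n_def)
  have lowdeg: "D \<le> mldegree k c'" if "is_approx k (sign_cube k) (2 * \<gamma>) F c'" for c'
  proof -
    have "approx_degree k (sign_cube k) (2 * \<gamma>) F \<le> enat (mldegree k c')"
      unfolding approx_degree_def using that by (intro Inf_lower) auto
    then show ?thesis using assms(9) by simp
  qed
  have "M \<ge> 0"
    unfolding M_def margin_weight_def by (intro Inf_greatest) (auto simp: nonconst_weight_nonneg)
  have main: "t * D \<le> 2 * mldegree d c" if c: "is_approx d \<Y> \<gamma> G c" "weight d c \<le> W" for c
  proof (rule ccontr)
    assume "\<not> t * D \<le> 2 * mldegree d c"
    then have deg: "2 * mldegree (k * n) c < t * D" by (simp add: d)
    then have "D > 0" by (cases D) auto
    \<comment> \<open>Otherwise \<open>c\<close> is zero, so 0 approximates the sign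
      \<open>G z\<close> at a point of the nonempty \<open>\<Y>\<close> and
      \<open>\<gamma> \<ge> 1\<close>. Then 0 also approximates \<open>F\<close> within
      \<open>2 * \<gamma>\<close>, which forces \<open>D = 0\<close>.\<close>
    have W0: "W > 0"
    proof (rule ccontr)
      assume "\<not> W > 0"
      then have "(\<Sum>S\<in>Pow {..<d}. \<bar>c S\<bar>) = 0"
        using c(2) by (intro antisym sum_nonneg) (auto simp: weight_def)
      then have "\<forall>S\<in>Pow {..<d}. c S = 0" by (subst (asm) sum_nonneg_eq_0_iff) auto
      then have "mleval d c z = 0" for z by (simp add: mleval_def)
      moreover obtain z where z: "z \<in> \<Y>" using assms(12) by auto
      ultimately have "\<bar>G z\<bar> \<le> \<gamma>" using c(1) by (force simp: is_approx_def)
      obtain ys where ys: "ys \<in> tuples Y k" "z = concat ys" using z assms(11) by auto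
      have "map f ys \<in> sign_cube k" using ys assms(7) by (auto simp: tuples_def sign_cube_def)
      then have "\<bar>G z\<bar> = 1" using ys assms(8,10) by force
      with \<open>\<bar>G z\<bar> \<le> \<gamma>\<close> have "\<gamma> \<ge> 1" by simp
      then have "is_approx k (sign_cube k) (2 * \<gamma>) F (\<lambda>_. 0)"
        using assms(8) by (fastforce simp: is_approx_def mleval_def)
      moreover have "mldegree k (\<lambda>_. 0) \<le> 0" by (subst mldegree_le_iff) simp
      ultimately show False using lowdeg \<open>D > 0\<close> by fastforce
    qed
    \<comment> \<open>A positive real below \<open>M\<close> is required, whereas \<open>M\<close>
      ranges over \<open>[0, \<infinity>]\<close>. As \<open>D > 0\<close>, \<open>M = 0\<close>
      would make the bound on \<open>W\<close> nonpositive.\<close>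
    obtain w where w: "w > 0" "ereal w \<le> M" "2 ^ k * W \<le> \<gamma> * w powr (real D / 2)"
    proof (cases M)
      case (real r)
      have "ereal W \<le> ereal (\<gamma> * 2 powr - real k * r powr (real D / 2))"
        using assms(17) real \<open>D > 0\<close> by (simp add: epowr_def M_def n_def)
      then have W: "2 ^ k * W \<le> \<gamma> * r powr (real D / 2)"
        by (simp add: powr_minus powr_realpow field_simps)
      moreover have "r > 0"
      proof (rule ccontr)
        assume "\<not> r > 0"
        then have "r = 0" using \<open>M \<ge> 0\<close> real by simp
        then have "2 ^ k * W \<le> 0" using W by simp
        moreover have "2 ^ k * W > 0" using W0 by simp
        ultimately show False by simp
      qed
      ultimately show ?thesis using real that by simp
    next
      case PInf
      \<comment> \<open>With infinite margin weight any positive \<open>w\<close> is allowed; this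
        one makes the budget inequality an equality.\<close>
      define v where "v = 2 ^ k * W / \<gamma>"
      have "v > 0" using W0 \<open>\<gamma> > 0\<close> by (simp add: v_def)
      then have "(v powr (2 / real D)) powr (real D / 2) = v"
        using \<open>D > 0\<close> by (simp add: powr_powr)
      then show ?thesis
        using that[of "v powr (2 / real D)"] PInf W0 \<open>v > 0\<close> \<open>\<gamma> > 0\<close> by (simp add: v_def)
    next
      case MInf
      then show ?thesis using \<open>M \<ge> 0\<close> by simp
    qed
    have "\<bar>F (map f ys) - mleval (k * n) c (concat ys)\<bar> \<le> \<gamma>" if ys: "ys \<in> tuples H k" for ys
    proof -
      \<comment> \<open>A tuple with all blocks in \<open>H\<close> cannot fall outside
        \<open>\<Y>\<close>, since that would require a block in \<open>Y - H\<close>.\<close>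
      have "ys \<in> tuples Y k" using ys assms(13) by (auto simp: tuples_def)
      moreover have "\<forall>i<k. ys ! i \<in> H" using ys by (auto simp: tuples_def)
      ultimately have "concat ys \<in> \<Y>" using assms(15) by blast
      then show ?thesis
        using c(1) assms(10) \<open>ys \<in> tuples Y k\<close> by (auto simp: is_approx_def d)
    qed
    moreover have "2 ^ k * weight (k * n) c \<le> \<gamma> * w powr (real D / 2)"
      using c(2) w(3) by (smt (verit) d mult_left_mono zero_le_power)
    ultimately obtain c' where "mldegree k c' < D" "is_approx k (sign_cube k) (2 * \<gamma>) F c'"
      using truncated_expectation_approx[of H n f k F c \<gamma> w t D] assms(4,5,7,13,14) w deg
        finite_subset[OF assms(13,4)]
      unfolding M_def n_def[symmetric] by blast
    then show False using lowdeg by fastforce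
  qed
  \<comment> \<open>The infimum lives in \<open>enat\<close>, so the possibly half-integral bound is
    rounded up first; degrees are integers and still satisfy it.\<close>
  have "enat (nat \<lceil>real t * real D / 2\<rceil>) \<le> approx_weight_degree d \<Y> \<gamma> W G"
    unfolding approx_weight_degree_def
  proof (rule Inf_greatest)
    fix e assume "e \<in> {enat (mldegree d c) |c. is_approx d \<Y> \<gamma> G c \<and> weight d c \<le> W}"
    then obtain c where "e = enat (mldegree d c)" "t * D \<le> 2 * mldegree d c" using main by auto
    moreover from this have "real t * real D \<le> 2 * real (mldegree d c)"
      by (metis of_nat_le_iff of_nat_mult of_nat_numeral)
    ultimately show "enat (nat \<lceil>real t * real D / 2\<rceil>) \<le> e"
      by (simp add: nat_le_iff ceiling_le_iff)
  qed
  then have "ereal_of_enat (enat (nat \<lceil>real t * real D / 2\<rceil>))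
      \<le> ereal_of_enat (approx_weight_degree d \<Y> \<gamma> W G)"
    by (simp only: ereal_of_enat_le_iff)
  moreover have "real t * real D / 2 \<le> real (nat \<lceil>real t * real D / 2\<rceil>)" by linarith
  then have "ereal (real t * real D / 2) \<le> ereal_of_enat (enat (nat \<lceil>real t * real D / 2\<rceil>))"
    by simp
  ultimately show ?thesis by (rule order_trans[rotated])
qed

end
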